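(* Let $J^\alpha f=K_\alpha\ast f$ be a family of operators defined by convolution, where $K_\alpha,f:(0,\infty)\rightarrow\mathbb{R}$, $\alpha\in(0,\infty)$, and $K_\alpha,f\in\mathcal{L}$. Suppose: - Identity: $K_1=1$ on $(0,\infty)$, i.e. $J^1f$ is the ordinary integral; - Index law: $J^{\alpha+\beta}=J^\alpha\circ J^\beta$ on $\mathcal{L}$ for all $\alpha,\beta\in(0,\infty)$; - Continuity: for all $x\in(0,\infty)$, the map $\alpha\mapsto\widehat{K}_\alpha(x)$ from $(0,\infty)$ to $\mathbb{R}$ is continuous at one point. (This condition is equivalent to: for all $f\in\mathcal{L}$ and $x\in(0,\infty)$, the map $\alpha\mapsto\widehat{J^\alpha f}(x)$ from $(0,\infty)$ to $\mathbb{R}$ is continuous at one point.) Then $J^\alpha=I^\alpha$ is the Riemann-Liouville integral on $\mathcal{L}$, for all $\alpha\in(0,\infty)$.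
   Context: $\mathcal{L}$ is the set of Laplace transformable functions $f:(0,\infty)\to\mathbb{R}$, i.e. those for which the Laplace transform $\widehat{f}(x):=\int_0^\infty f(s)\mathrm{e}^{-sx}\,\mathrm{d}s$ is well-defined (as a Lebesgue integral) for all $x>0$; in particular $f\in\mathrm{L}^1(0,T)$ for all $T>0$. The hat denotes the Laplace transform on $(0,\infty)$. Convolution is $(K\ast f)(t)=\int_0^tK(t-s)f(s)\,\mathrm{d}s$. $I^\alpha f(t)=\frac{1}{\Gamma(\alpha)}\int_0^t(t-s)^{\alpha-1}f(s)\,\mathrm{d}s$ is the Riemann-Liouville integral with left origin $0$. Functions are identified when equal almost everywhere. *)

theory Defs
  imports "HOL-Analysis.Analysis"
begin

text \<open>
  A function \<open>(0,\<infinity>) \<rightarrow> \<real>\<close> is represented by a total function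
  \<open>real \<Rightarrow> real\<close> whose values outside \<open>(0,\<infinity>)\<close> are never used.
\<close>

definition ae_eq :: "(real \<Rightarrow> real) \<Rightarrow> (real \<Rightarrow> real) \<Rightarrow> bool"  (infix "=\<^sub>a\<^sub>e" 50)
  where "f =\<^sub>a\<^sub>e g \<longleftrightarrow> (AE t in lebesgue. 0 < t \<longrightarrow> f t = g t)"

definition laplace_transformable :: "(real \<Rightarrow> real) set"
  where "laplace_transformable =
    {f. \<forall>x>0. set_integrable lebesgue {0<..} (\<lambda>s. f s * exp (- (s * x)))}"

definition laplace :: "(real \<Rightarrow> real) \<Rightarrow> real \<Rightarrow> real"
  where "laplace f x = (LINT s:{0<..}|lebesgue. f s * exp (- (s * x)))"

text \<open>
  For \<open>K\<close> and \<open>f\<close> in \<open>laplace_transformable\<close> the integral below exists for almost every \<open>t > 0\<close>;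
  at the remaining points the library integral is \<open>0\<close>, which is harmless modulo \<open>=\<^sub>a\<^sub>e\<close>.
\<close>

definition convolution :: "(real \<Rightarrow> real) \<Rightarrow> (real \<Rightarrow> real) \<Rightarrow> real \<Rightarrow> real"
  where "convolution K f t = (LINT s:{0<..<t}|lebesgue. K (t - s) * f s)"

definition RL_integral :: "real \<Rightarrow> (real \<Rightarrow> real) \<Rightarrow> real \<Rightarrow> real"
  where "RL_integral \<alpha> f t =
    1 / Gamma \<alpha> * (LINT s:{0<..<t}|lebesgue. (t - s) powr (\<alpha> - 1) * f s)"

end

theory Submission
  imports Defs "HOL-Probability.Distribution_Functions"
begin

text \<open>
  By the convolution theorem, evaluating the index law at \<open>f = 1\<close> shows that, for fixed \<open>x > 0\<close>, the map
  \<open>\<alpha> \<mapsto> laplace (K \<alpha>) x\<close> is multiplicative, with value \<open>1 / x\<close> at \<open>\<alpha> = 1\<close>. Its logarithm is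
  additive and continuous at one point, hence linear, so \<open>laplace (K \<alpha>) x = x powr (- \<alpha>)\<close>, which is
  the transform of the Riemann-Liouville kernel. The claim follows by injectivity of the Laplace
  transform, a consequence of Weierstrass approximation after the substitution \<open>u = exp (- s)\<close>.
\<close>

section \<open>Borel representatives\<close>

text \<open>
  For merely Lebesgue measurable \<open>K\<close> and \<open>f\<close>, the integrand \<open>K (t - s) * f s\<close> need not be measurable
  for the product of the Lebesgue measures, so Fubini's theorem is applied to Borel representatives.
\<close>

definition borel_version :: "(real \<Rightarrow> real) \<Rightarrow> (real \<Rightarrow> real) \<Rightarrow> bool"
  where "borel_version f g \<longleftrightarrow>
    g \<in> borel_measurable borel \<and> (\<forall>t\<le>0. g t = 0) \<and> (AE t in lborel. 0 < t \<longrightarrow> f t = g t)"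

lemma borel_version_exists:
  assumes "f \<in> laplace_transformable"
  obtains g where "borel_version f g"
proof -
  \<comment> \<open>Integrability at the single point \<open>x = 1\<close> makes the damped function
    Lebesgue measurable; multiplying a Borel version \<open>h\<close> of it by \<open>exp s\<close>
    undoes the damping.\<close>
  have "set_integrable lebesgue {0<..} (\<lambda>s. f s * exp (- (s * 1)))"
    using assms zero_less_one unfolding laplace_transformable_def by blast
  then have "(\<lambda>s. indicator {0<..} s * (f s * exp (- s))) \<in> borel_measurable lebesgue"
    by (auto simp: set_integrable_def dest: borel_measurable_integrable)
  then obtain h where h: "h \<in> borel_measurable lborel"
      "AE s in lborel. indicator {0<..} s * (f s * exp (- s)) = h s"
    using completion_ex_borel_measurable_real by blast
  show thesis
  proof (rule that)
    show "borel_version f (\<lambda>s. indicator {0<..} s * (h s * exp s))"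
      unfolding borel_version_def
    proof (intro conjI)
      show "(\<lambda>s. indicator {0<..} s * (h s * exp s)) \<in> borel_measurable borel"
        using h(1) by simp
      show "AE t in lborel. 0 < t \<longrightarrow> f t = indicator {0<..} t * (h t * exp t)"
        using h(2) by eventually_elim (auto simp: exp_minus field_simps)
    qed auto
  qed
qed

text \<open>Lebesgue measure is the completion of \<open>lborel\<close>: a function almost
  everywhere equal to a Borel function is measurable for the completion, and completing the measure
  does not change integrals of Borel functions.\<close>

lemma lebesgue_integral_AE_eq_lborel:
  fixes f g :: "real \<Rightarrow> real"
  assumes [measurable]: "g \<in> borel_measurable borel" and ae: "AE t in lborel. f t = g t"
  shows "integrable lebesgue f \<longleftrightarrow> integrable lborel g"
    and "integral\<^sup>L lebesgue f = integral\<^sup>L lborel g"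
proof -
  have g: "g \<in> borel_measurable lebesgue"
    by (rule measurable_completion) simp
  have ae': "AE t in lebesgue. f t = g t"
    using ae by (rule AE_completion)
  have f: "f \<in> borel_measurable lebesgue"
    by (rule borel_measurable_AE[OF g]) (use ae' in \<open>auto simp: eq_commute\<close>)
  show "integrable lebesgue f \<longleftrightarrow> integrable lborel g"
    using integrable_cong_AE[OF f g ae'] integrable_completion[of g lborel] by simp
  show "integral\<^sup>L lebesgue f = integral\<^sup>L lborel g"
    using integral_cong_AE[OF f g ae'] integral_completion[of g lborel] by simp
qed

context
  fixes f g :: "real \<Rightarrow> real"
  assumes version: "borel_version f g"
begin

lemma borel_version_measurable: "g \<in> borel_measurable borel"
  and borel_version_nonpos: "t \<le> 0 \<Longrightarrow> g t = 0"
  and borel_version_AE: "AE t in lborel. 0 < t \<longrightarrow> f t = g t"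
  using version unfolding borel_version_def by blast+

text \<open>Since \<open>g\<close> vanishes for \<open>t \<le> 0\<close>, it absorbs the indicator
  of the half line, so transforms become plain integrals over \<open>lborel\<close>.\<close>

lemma borel_version_AE_indicator:
  "AE s in lborel. indicator {0<..} s *\<^sub>R (f s * exp (- (s * x))) = g s * exp (- (s * x))"
  using borel_version_AE by eventually_elim (auto simp: borel_version_nonpos indicator_def)

lemma borel_version_transformable_iff:
  "f \<in> laplace_transformable \<longleftrightarrow> (\<forall>x>0. integrable lborel (\<lambda>s. g s * exp (- (s * x))))"
  unfolding laplace_transformable_def set_integrable_def
  using lebesgue_integral_AE_eq_lborel(1)[OF _ borel_version_AE_indicator] borel_version_measurable
  by simp

lemma borel_version_laplace:
  "laplace f x = (\<integral>s. g s * exp (- (s * x)) \<partial>lborel)"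
  unfolding laplace_def set_lebesgue_integral_def
  using borel_version_measurable
  by (intro lebesgue_integral_AE_eq_lborel(2) borel_version_AE_indicator) simp

end

lemma ae_eq_iff_lborel: "f =\<^sub>a\<^sub>e g \<longleftrightarrow> (AE t in lborel. 0 < t \<longrightarrow> f t = g t)"
  unfolding ae_eq_def AE_completion_iff ..

lemma ae_eq_borel_version:
  assumes "borel_version f h" "g =\<^sub>a\<^sub>e f" shows "borel_version g h"
  using assms unfolding borel_version_def ae_eq_iff_lborel
  by (auto elim: eventually_elim2)

text \<open>Almost everywhere equal functions share a Borel representative, and that representative
  determines both transformability and the transform.\<close>

lemma laplace_cong_ae:
  assumes "f \<in> laplace_transformable" "g =\<^sub>a\<^sub>e f"
  shows "g \<in> laplace_transformable" and "laplace g x = laplace f x"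
proof -
  obtain h where h: "borel_version f h"
    using borel_version_exists assms(1) .
  note h' = ae_eq_borel_version[OF h assms(2)]
  show "g \<in> laplace_transformable"
    using assms(1) borel_version_transformable_iff[OF h] borel_version_transformable_iff[OF h'] by simp
  show "laplace g x = laplace f x"
    using borel_version_laplace[OF h] borel_version_laplace[OF h'] by simp
qed

section \<open>Convolution theorem\<close>

text \<open>Affine maps preserve null sets. The exceptional set is first enclosed in a Borel null
  set \<open>N\<close>, because \<open>P\<close> need not be measurable.\<close>

lemma AE_lborel_reflect:
  assumes "AE s in lborel. P s" shows "AE s in lborel. P (t - s :: real)"
proof -
  obtain N where N: "N \<in> sets lborel" "{s. \<not> P s} \<subseteq> N" "emeasure lborel N = 0"
    using assms by (auto elim!: AE_E)
  have "AE s in lborel. s \<notin> N"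
    using N by (intro AE_not_in) auto
  then have "AE s in lborel. t + (-1) * s \<notin> N"
    using N(1) by (intro AE_borel_affine) (auto simp: pred_def)
  then show ?thesis
    by (rule eventually_mono) (use N(2) in auto)
qed

text \<open>The cutoff to \<open>0 < s < t\<close> is automatic: \<open>g s\<close> vanishes for
  \<open>s \<le> 0\<close> and \<open>k (t - s)\<close> for \<open>s \<ge> t\<close>. The equality
  holds at every \<open>t\<close>; where the integrals do not exist, both sides have the default
  value 0.\<close>

lemma borel_version_convolution_eq:
  assumes k: "borel_version K k" and g: "borel_version f g"
  shows "convolution K f t = (\<integral>s. k (t - s) * g s \<partial>lborel)"
  unfolding convolution_def set_lebesgue_integral_def
proof (rule lebesgue_integral_AE_eq_lborel(2))
  show "(\<lambda>s. k (t - s) * g s) \<in> borel_measurable borel"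
    using borel_version_measurable[OF k] borel_version_measurable[OF g] by measurable
  show "AE s in lborel. indicator {0<..<t} s *\<^sub>R (K (t - s) * f s) = k (t - s) * g s"
    using AE_lborel_reflect[OF borel_version_AE[OF k], of t] borel_version_AE[OF g]
    by eventually_elim
      (auto simp: indicator_def borel_version_nonpos[OF k] borel_version_nonpos[OF g])
qed

lemma convolution_lborel:
  fixes F G :: "real \<Rightarrow> real"
  assumes F: "integrable lborel F" and G: "integrable lborel G"
  shows "integrable lborel (\<lambda>t. \<integral>s. F (t - s) * G s \<partial>lborel)"
    and "(\<integral>t. \<integral>s. F (t - s) * G s \<partial>lborel \<partial>lborel) = integral\<^sup>L lborel F * integral\<^sup>L lborel G"
proof -
  have [measurable]: "F \<in> borel_measurable borel" "G \<in> borel_measurable borel"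
    using F G by (auto dest: borel_measurable_integrable)
  have shift_int: "integrable lborel (\<lambda>t. F (t - s))" for s
    using lborel_integrable_real_affine[OF F, of 1 "-s"] by simp
  have shift: "(\<integral>t. F (t - s) \<partial>lborel) = integral\<^sup>L lborel F" for s
    using lborel_integral_real_affine[of 1 F "-s"] by simp
  have shift_abs: "(\<integral>t. \<bar>F (t - s)\<bar> \<partial>lborel) = (\<integral>t. \<bar>F t\<bar> \<partial>lborel)" for s
    using lborel_integral_real_affine[of 1 "\<lambda>t. \<bar>F t\<bar>" "-s"] by simp
  \<comment> \<open>With \<open>s\<close> as outer variable, the inner integral of the absolute
    value is \<open>\<bar>G s\<bar>\<close> times the L1 norm of \<open>F\<close>, by translation
    invariance.\<close>
  have int: "integrable (lborel \<Otimes>\<^sub>M lborel) (\<lambda>(s, t). F (t - s) * G s)"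
  proof (rule lborel_pair.Fubini_integrable)
    show "integrable lborel (\<lambda>s. \<integral>t. norm (case (s, t) of (s, t) \<Rightarrow> F (t - s) * G s) \<partial>lborel)"
      using G by (simp add: abs_mult shift_abs)
    show "AE s in lborel. integrable lborel (\<lambda>t. case (s, t) of (s, t) \<Rightarrow> F (t - s) * G s)"
      using shift_int by simp
  qed measurable
  show "integrable lborel (\<lambda>t. \<integral>s. F (t - s) * G s \<partial>lborel)"
    using lborel_pair.integrable_snd[OF int] .
  show "(\<integral>t. \<integral>s. F (t - s) * G s \<partial>lborel \<partial>lborel) = integral\<^sup>L lborel F * integral\<^sup>L lborel G"
    using lborel_pair.Fubini_integral[OF int] by (simp add: shift)
qed

lemma borel_version_convolution:
  assumes k: "borel_version K k" and g: "borel_version f g"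
  shows "borel_version (convolution K f) (\<lambda>t. \<integral>s. k (t - s) * g s \<partial>lborel)"
  unfolding borel_version_def
proof (intro conjI allI impI)
  note [measurable] = borel_version_measurable[OF k] borel_version_measurable[OF g]
  show "(\<lambda>t. \<integral>s. k (t - s) * g s \<partial>lborel) \<in> borel_measurable borel"
    by measurable
  fix t :: real assume "t \<le> 0"
  then have "k (t - s) * g s = 0" for s
    by (cases "s \<le> 0") (auto simp: borel_version_nonpos[OF k] borel_version_nonpos[OF g])
  then show "(\<integral>s. k (t - s) * g s \<partial>lborel) = 0"
    by (simp only: integral_zero)
next
  show "AE t in lborel. 0 < t \<longrightarrow> convolution K f t = (\<integral>s. k (t - s) * g s \<partial>lborel)"
    by (simp add: borel_version_convolution_eq[OF k g])
qed

lemma laplace_convolution: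
  assumes K: "K \<in> laplace_transformable" and f: "f \<in> laplace_transformable"
  shows "convolution K f \<in> laplace_transformable"
    and "0 < x \<Longrightarrow> laplace (convolution K f) x = laplace K x * laplace f x"
proof -
  obtain k where k: "borel_version K k" using borel_version_exists K .
  obtain g where g: "borel_version f g" using borel_version_exists f .
  note kg = borel_version_convolution[OF k g]
  \<comment> \<open>The weight splits along \<open>t = (t - s) + s\<close>, so the damped
    convolution is the convolution of the damped functions.\<close>
  have eq: "(\<integral>s. k (t - s) * g s \<partial>lborel) * exp (- (t * x))
      = (\<integral>s. (k (t - s) * exp (- ((t - s) * x))) * (g s * exp (- (s * x))) \<partial>lborel)" for t x
    unfolding integral_mult_left_zero[symmetric]
    by (intro Bochner_Integration.integral_cong refl) (simp add: mult_exp_exp algebra_simps)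
  have int: "integrable lborel (\<lambda>s. k s * exp (- (s * x)))" "integrable lborel (\<lambda>s. g s * exp (- (s * x)))"
    if "0 < x" for x
    using that K f borel_version_transformable_iff[OF k] borel_version_transformable_iff[OF g] by auto
  show "convolution K f \<in> laplace_transformable"
    unfolding borel_version_transformable_iff[OF kg] eq
    using convolution_lborel(1)[OF int] by simp
  show "laplace (convolution K f) x = laplace K x * laplace f x" if "0 < x"
    unfolding borel_version_laplace[OF kg] borel_version_laplace[OF k] borel_version_laplace[OF g] eq
    using convolution_lborel(2)[OF int] that by simp
qed

section \<open>Injectivity of the Laplace transform\<close>

text \<open>The positive and negative parts of \<open>h\<close> are densities of finite measures
  with equal distribution functions. The measures therefore coincide, and densities with respect to
  \<open>lborel\<close> are unique almost everywhere.\<close>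

lemma integral_zero_imp_AE_zero:
  fixes h :: "real \<Rightarrow> real"
  assumes h: "integrable lborel h"
    and zero: "\<And>b. (\<integral>s. h s * indicator {..b} s \<partial>lborel) = 0"
  shows "AE s in lborel. h s = 0"
proof -
  define p where "p = (\<lambda>s. max 0 (h s))"
  define m where "m = (\<lambda>s. max 0 (- h s))"
  have [measurable]: "h \<in> borel_measurable borel"
    using h by (auto dest: borel_measurable_integrable)
  have [measurable]: "p \<in> borel_measurable borel" "m \<in> borel_measurable borel"
    unfolding p_def m_def by measurable
  have int: "integrable lborel p" "integrable lborel m"
    unfolding p_def m_def using h by auto
  have nn: "0 \<le> p s" "0 \<le> m s" and h_eq: "h s = p s - m s" for s
    by (auto simp: p_def m_def)
  have finite: "finite_borel_measure (density lborel (\<lambda>s. ennreal (q s)))"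
    if q: "integrable lborel q" "\<And>s. 0 \<le> q s" for q :: "real \<Rightarrow> real"
  proof (intro finite_borel_measure.intro finite_measureI finite_borel_measure_axioms.intro)
    have "q \<in> borel_measurable borel"
      using q(1) by (auto dest: borel_measurable_integrable)
    then show "emeasure (density lborel (\<lambda>s. ennreal (q s))) (space (density lborel (\<lambda>s. ennreal (q s)))) \<noteq> \<infinity>"
      using nn_integral_eq_integral[OF q(1)] q(2) by (simp add: emeasure_density)
  qed simp
  have cdf: "cdf (density lborel (\<lambda>s. ennreal (q s))) b = (\<integral>s. q s * indicator {..b} s \<partial>lborel)"
    if q: "integrable lborel q" "\<And>s. 0 \<le> q s" for q :: "real \<Rightarrow> real" and b
  proof -
    have [measurable]: "q \<in> borel_measurable borel"
      using q(1) by (auto dest: borel_measurable_integrable)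
    have "(\<integral>\<^sup>+ s. ennreal (q s) * indicator {..b} s \<partial>lborel) = (\<integral>\<^sup>+ s. ennreal (q s * indicator {..b} s) \<partial>lborel)"
      by (intro nn_integral_cong) (auto split: split_indicator)
    also have "\<dots> = ennreal (\<integral>s. q s * indicator {..b} s \<partial>lborel)"
      using q integrable_mult_indicator[of "{..b}" lborel q]
      by (intro nn_integral_eq_integral) (auto simp: mult.commute)
    finally show ?thesis
      using q(2) by (simp add: cdf_def measure_def emeasure_density)
  qed
  have "cdf (density lborel (\<lambda>s. ennreal (p s))) b = cdf (density lborel (\<lambda>s. ennreal (m s))) b" for b
  proof -
    have "integrable lborel (\<lambda>s. p s * indicator {..b} s)" "integrable lborel (\<lambda>s. m s * indicator {..b} s)"
      using integrable_mult_indicator[of "{..b}" lborel p] integrable_mult_indicator[of "{..b}" lborel m] int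
      by (auto simp: mult.commute)
    then show ?thesis
      using zero[of b] by (simp add: cdf int nn h_eq left_diff_distrib)
  qed
  then have "density lborel (\<lambda>s. ennreal (p s)) = density lborel (\<lambda>s. ennreal (m s))"
    using finite int nn by (intro cdf_unique' ext) auto
  then have "AE s in lborel. ennreal (p s) = ennreal (m s)"
    by (subst (asm) sigma_finite_measure.density_unique_iff[OF lborel.sigma_finite_measure_axioms]) auto
  then show ?thesis
    by eventually_elim (auto simp: h_eq nn)
qed

text \<open>In the variable \<open>u = exp (- s)\<close>, \<open>h\<close> annihilates all
  monomials. This passes to polynomials by linearity, to continuous functions by uniform
  approximation on the unit interval, and to indicators of half lines by dominated
  convergence.\<close>

lemma moments_exp_zero_imp_AE_zero:
  fixes h :: "real \<Rightarrow> real"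
  assumes h: "integrable lborel h" and nonpos: "\<And>t. t \<le> 0 \<Longrightarrow> h t = 0"
    and zero: "\<And>n::nat. (\<integral>s. h s * exp (- s) ^ n \<partial>lborel) = 0"
  shows "AE s in lborel. h s = 0"
proof (rule integral_zero_imp_AE_zero[OF h])
  have [measurable]: "h \<in> borel_measurable borel"
    using h by (auto dest: borel_measurable_integrable)
  \<comment> \<open>Bounds on the unit interval suffice: \<open>h\<close> vanishes unless
    \<open>s > 0\<close>, and then \<open>exp (- s)\<close> lies between 0 and 1.\<close>
  have int_bounded: "integrable lborel (\<lambda>s. h s * \<phi> (exp (- s)))"
    if [measurable]: "\<phi> \<in> borel_measurable borel" and B: "\<And>u. 0 \<le> u \<Longrightarrow> u \<le> 1 \<Longrightarrow> \<bar>\<phi> u\<bar> \<le> B" for \<phi> and B :: real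
  proof (rule Bochner_Integration.integrable_bound)
    show "integrable lborel (\<lambda>s. B * h s)" using h by simp
    show "AE s in lborel. norm (h s * \<phi> (exp (- s))) \<le> norm (B * h s)"
    proof (intro AE_I2)
      fix s
      show "norm (h s * \<phi> (exp (- s))) \<le> norm (B * h s)"
      proof (cases "s \<le> 0")
        case False
        then have "\<bar>\<phi> (exp (- s))\<bar> \<le> \<bar>B\<bar>"
          using B[of "exp (- s)"] by simp
        then show ?thesis
          using mult_left_mono[of "\<bar>\<phi> (exp (- s))\<bar>" "\<bar>B\<bar>" "\<bar>h s\<bar>"]
          by (simp add: abs_mult mult.commute)
      qed (simp add: nonpos)
    qed
  qed simp
  have poly: "(\<integral>s. h s * p (exp (- s)) \<partial>lborel) = 0" if rp: "real_polynomial_function p" for p :: "real \<Rightarrow> real"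
  proof -
    obtain a n where p: "p = (\<lambda>x. \<Sum>i\<le>n. a i * x ^ i)"
      using rp real_polynomial_function_iff_sum[of p] by auto
    have "integrable lborel (\<lambda>s. h s * exp (- s) ^ i)" for i
      by (rule int_bounded[of "\<lambda>u. u ^ i" 1]) (auto simp: power_le_one abs_if)
    then have "(\<integral>s. (\<Sum>i\<le>n. a i * (h s * exp (- s) ^ i)) \<partial>lborel) = 0"
      by (subst Bochner_Integration.integral_sum) (auto simp: zero)
    then show ?thesis
      by (simp add: p sum_distrib_left mult.left_commute)
  qed
  have cont: "(\<integral>s. h s * \<phi> (exp (- s)) \<partial>lborel) = 0" if \<phi>: "continuous_on UNIV \<phi>" for \<phi> :: "real \<Rightarrow> real"
  proof -
    define I where "I = (\<integral>s. \<bar>h s\<bar> \<partial>lborel)"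
    have I: "0 \<le> I" unfolding I_def by simp
    have [measurable]: "\<phi> \<in> borel_measurable borel"
      using \<phi> by (rule borel_measurable_continuous_onI)
    have bounded: "\<exists>B. \<forall>u. 0 \<le> u \<and> u \<le> 1 \<longrightarrow> \<bar>q u\<bar> \<le> B" if "continuous_on UNIV q" for q :: "real \<Rightarrow> real"
    proof -
      have "compact (q ` {0..1})"
        using that by (intro compact_continuous_image continuous_on_subset[OF that]) auto
      then show ?thesis
        by (force dest!: compact_imp_bounded simp: bounded_iff)
    qed
    \<comment> \<open>Replacing \<open>\<phi>\<close> by a polynomial within \<open>e\<close> costs
      at most \<open>e\<close> times the L1 norm \<open>I\<close> of \<open>h\<close>, and the
      polynomial contributes zero.\<close>
    have small: "\<bar>\<integral>s. h s * \<phi> (exp (- s)) \<partial>lborel\<bar> \<le> e * I" if e: "0 < e" for e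
    proof -
      obtain p where p: "real_polynomial_function p" "\<And>u. u \<in> {0..1} \<Longrightarrow> \<bar>\<phi> u - p u\<bar> < e"
        using Stone_Weierstrass_real_polynomial_function[of "{0..1::real}" \<phi> e] \<phi> e
        by (auto intro: continuous_on_subset)
      have pc: "continuous_on UNIV p"
        using p(1) by (simp add: continuous_on_polymonial_function real_polynomial_function_eq)
      then have [measurable]: "p \<in> borel_measurable borel"
        by (rule borel_measurable_continuous_onI)
      have "integrable lborel (\<lambda>s. h s * \<phi> (exp (- s)))" "integrable lborel (\<lambda>s. h s * p (exp (- s)))"
        using bounded[OF \<phi>] bounded[OF pc] by (auto intro!: int_bounded)
      then have "(\<integral>s. h s * \<phi> (exp (- s)) \<partial>lborel) = (\<integral>s. h s * (\<phi> (exp (- s)) - p (exp (- s))) \<partial>lborel)"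
        by (simp add: right_diff_distrib poly[OF p(1)])
      also have "\<bar>\<dots>\<bar> \<le> (\<integral>s. \<bar>h s * (\<phi> (exp (- s)) - p (exp (- s)))\<bar> \<partial>lborel)"
        using integral_norm_bound[of lborel "\<lambda>s. h s * (\<phi> (exp (- s)) - p (exp (- s)))"] by simp
      also have "\<dots> \<le> (\<integral>s. e * \<bar>h s\<bar> \<partial>lborel)"
      proof (rule integral_mono_AE')
        show "integrable lborel (\<lambda>s. e * \<bar>h s\<bar>)" using h by simp
        show "AE s in lborel. \<bar>h s * (\<phi> (exp (- s)) - p (exp (- s)))\<bar> \<le> e * \<bar>h s\<bar>"
        proof (intro AE_I2)
          fix s
          show "\<bar>h s * (\<phi> (exp (- s)) - p (exp (- s)))\<bar> \<le> e * \<bar>h s\<bar>"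
          proof (cases "s \<le> 0")
            case False
            then have "\<bar>\<phi> (exp (- s)) - p (exp (- s))\<bar> \<le> e"
              using p(2)[of "exp (- s)"] by simp
            from mult_left_mono[OF this, of "\<bar>h s\<bar>"] show ?thesis
              by (simp add: abs_mult mult.commute)
          qed (simp add: nonpos)
        qed
      qed (use e in simp)
      finally show ?thesis by (simp add: I_def)
    qed
    show ?thesis
    proof (rule ccontr)
      assume neq: "(\<integral>s. h s * \<phi> (exp (- s)) \<partial>lborel) \<noteq> 0" (is "?J \<noteq> 0")
      \<comment> \<open>This choice of \<open>e\<close> makes the bound less than half of
        \<open>\<bar>?J\<bar>\<close>; the summand 1 covers the case \<open>I = 0\<close>.\<close>
      have "\<bar>?J\<bar> \<le> \<bar>?J\<bar> / (2 * (I + 1)) * I"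
        using neq I by (intro small) auto
      also have "\<dots> < \<bar>?J\<bar>"
        using neq I by (simp add: field_simps add_nonneg_pos)
      finally show False by simp
    qed
  qed
  fix b
  \<comment> \<open>continuous functions of \<open>exp (- s)\<close> decreasing to the indicator of \<open>s \<le> b\<close>\<close>
  define \<phi> where "\<phi> = (\<lambda>n u. min 1 (max 0 (real n * (u - exp (- b)) + 1)))"
  have lim: "(\<lambda>n. \<phi> n (exp (- s))) \<longlonglongrightarrow> indicator {..b} s" for s
  proof (cases "s \<le> b")
    case True
    then have "\<phi> n (exp (- s)) = 1" for n
      by (simp add: \<phi>_def)
    then show ?thesis using True by simp
  next
    case False
    define d where "d = exp (- b) - exp (- s)"
    have d: "0 < d" using False by (simp add: d_def)
    \<comment> \<open>Once \<open>n * d > 1\<close>, the ramp has already reached zero at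
      \<open>exp (- s)\<close>, so the sequence is eventually constant.\<close>
    obtain N :: nat where N: "1 < real N * d"
      using reals_Archimedean3[OF d] by blast
    have "\<phi> n (exp (- s)) = 0" if "N \<le> n" for n
    proof -
      have "real N * d \<le> real n * d"
        using that d by (intro mult_right_mono) auto
      then have "real n * (exp (- s) - exp (- b)) + 1 \<le> 0"
        using N by (simp add: d_def algebra_simps)
      then show ?thesis by (simp add: \<phi>_def)
    qed
    then have "\<forall>\<^sub>F n in sequentially. \<phi> n (exp (- s)) = indicator {..b} s"
      using False by (auto simp: eventually_sequentially)
    then show ?thesis by (rule tendsto_eventually)
  qed
  have [measurable]: "\<phi> n \<in> borel_measurable borel" for n
    unfolding \<phi>_def by measurable
  have "(\<lambda>n. \<integral>s. h s * \<phi> n (exp (- s)) \<partial>lborel) \<longlonglongrightarrow> (\<integral>s. h s * indicator {..b} s \<partial>lborel)"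
  proof (rule integral_dominated_convergence)
    show "integrable lborel (\<lambda>s. \<bar>h s\<bar>)" using h by simp
    show "AE s in lborel. (\<lambda>n. h s * \<phi> n (exp (- s))) \<longlonglongrightarrow> h s * indicator {..b} s"
      by (intro AE_I2 tendsto_mult_left lim)
    show "AE s in lborel. norm (h s * \<phi> n (exp (- s))) \<le> \<bar>h s\<bar>" for n
    proof (intro AE_I2)
      fix s
      have "\<bar>\<phi> n (exp (- s))\<bar> \<le> 1" by (simp add: \<phi>_def)
      then show "norm (h s * \<phi> n (exp (- s))) \<le> \<bar>h s\<bar>"
        by (simp add: abs_mult mult_left_le)
    qed
  qed measurable
  moreover have "(\<integral>s. h s * \<phi> n (exp (- s)) \<partial>lborel) = 0" for n
    unfolding \<phi>_def by (rule cont) (intro continuous_intros)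
  ultimately show "(\<integral>s. h s * indicator {..b} s \<partial>lborel) = 0"
    by (simp add: LIMSEQ_const_iff)
qed

text \<open>The difference of representatives need not be integrable, so one factor
  \<open>exp (- s)\<close> is spent on damping it. The moment of order \<open>n\<close> is then the
  difference of the transforms at \<open>1 + n\<close>.\<close>

theorem laplace_inject_ae:
  assumes f: "f \<in> laplace_transformable" and g: "g \<in> laplace_transformable"
    and eq: "\<And>x. 0 < x \<Longrightarrow> laplace f x = laplace g x"
  shows "f =\<^sub>a\<^sub>e g"
proof -
  obtain f' where f': "borel_version f f'" using borel_version_exists f .
  obtain g' where g': "borel_version g g'" using borel_version_exists g .
  have int: "integrable lborel (\<lambda>s. f' s * exp (- (s * x)))" "integrable lborel (\<lambda>s. g' s * exp (- (s * x)))"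
    if "0 < x" for x
    using that f g borel_version_transformable_iff[OF f'] borel_version_transformable_iff[OF g'] by auto
  have "AE s in lborel. (f' s - g' s) * exp (- s) = 0"
  proof (rule moments_exp_zero_imp_AE_zero)
    show "integrable lborel (\<lambda>s. (f' s - g' s) * exp (- s))"
      using Bochner_Integration.integrable_diff[OF int[of 1]] by (simp add: left_diff_distrib)
    show "(f' t - g' t) * exp (- t) = 0" if "t \<le> 0" for t
      using that by (simp add: borel_version_nonpos[OF f'] borel_version_nonpos[OF g'])
    fix n :: nat
    have "exp (- s) * exp (- s) ^ n = exp (- (s * (1 + real n)))" for s :: real
      by (simp add: exp_of_nat_mult[symmetric] mult_exp_exp algebra_simps)
    then have "(\<integral>s. (f' s - g' s) * exp (- s) * exp (- s) ^ n \<partial>lborel)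
        = (\<integral>s. f' s * exp (- (s * (1 + real n))) - g' s * exp (- (s * (1 + real n))) \<partial>lborel)"
      by (simp add: mult.assoc left_diff_distrib)
    also have "\<dots> = laplace f (1 + real n) - laplace g (1 + real n)"
      unfolding borel_version_laplace[OF f'] borel_version_laplace[OF g']
      by (intro Bochner_Integration.integral_diff int) auto
    finally show "(\<integral>s. (f' s - g' s) * exp (- s) * exp (- s) ^ n \<partial>lborel) = 0"
      using eq by simp
  qed
  then show ?thesis
    unfolding ae_eq_iff_lborel
    using borel_version_AE[OF f'] borel_version_AE[OF g'] by eventually_elim simp
qed

section \<open>The Riemann-Liouville kernel and its transform\<close>

definition RL_kernel :: "real \<Rightarrow> real \<Rightarrow> real"
  where "RL_kernel \<alpha> t = t powr (\<alpha> - 1) / Gamma \<alpha>"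

lemma RL_integral_eq_convolution: "RL_integral \<alpha> f = convolution (RL_kernel \<alpha>) f"
proof
  fix t
  have "convolution (RL_kernel \<alpha>) f t = (LINT s:{0<..<t}|lebesgue. 1 / Gamma \<alpha> * ((t - s) powr (\<alpha> - 1) * f s))"
    by (simp add: convolution_def RL_kernel_def)
  also have "\<dots> = RL_integral \<alpha> f t"
    unfolding RL_integral_def by (rule set_integral_mult_right)
  finally show "RL_integral \<alpha> f t = convolution (RL_kernel \<alpha>) f t" ..
qed

text \<open>Rescaling \<open>s\<close> to \<open>x * s\<close> turns the transform into Euler's
  integral for \<open>Gamma \<alpha>\<close>.\<close>

lemma RL_kernel_laplace:
  assumes "0 < \<alpha>"
  shows "RL_kernel \<alpha> \<in> laplace_transformable" and "0 < x \<Longrightarrow> laplace (RL_kernel \<alpha>) x = x powr (- \<alpha>)"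
proof -
  define k where "k = (\<lambda>t. indicator {0<..} t * RL_kernel \<alpha> t)"
  have measurable_k: "k \<in> borel_measurable borel"
    unfolding k_def RL_kernel_def by measurable
  have version: "borel_version (RL_kernel \<alpha>) k"
    unfolding borel_version_def using measurable_k by (simp, simp add: k_def)
  define I where "I = (\<lambda>t::real. indicator {0..} t * t powr (\<alpha> - 1) / exp t)"
  have "(\<integral>\<^sup>+t. ennreal (I t) \<partial>lborel) = ennreal (Gamma \<alpha>)"
    unfolding I_def by (rule Gamma_conv_nn_integral_real[OF assms, symmetric])
  then have I: "has_bochner_integral lborel I (Gamma \<alpha>)"
    using assms by (intro has_bochner_integral_nn_integral) (auto simp: I_def Gamma_real_pos less_imp_le)
  have G: "Gamma \<alpha> \<noteq> 0"
    using Gamma_real_pos[OF assms] by simp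
  \<comment> \<open>The form \<open>0 + x * s\<close> matches the affine change of variables applied
    below.\<close>
  have eq: "k s * exp (- (s * x)) = x powr (1 - \<alpha>) / Gamma \<alpha> * I (0 + x * s)" if "0 < x" for s x
  proof (cases "0 < s")
    case True
    have "x powr (1 - \<alpha>) * x powr (\<alpha> - 1) = 1"
      using that by (simp flip: powr_add)
    with True that show ?thesis
      by (simp add: k_def I_def RL_kernel_def powr_mult exp_minus field_simps)
  next
    case False
    with that show ?thesis
      \<comment> \<open>At \<open>s = 0\<close> the indicators in \<open>k\<close> and
        \<open>I\<close> differ, but \<open>0 powr (\<alpha> - 1) = 0\<close> by convention.\<close>
      by (cases "s = 0") (auto simp: k_def I_def indicator_def zero_le_mult_iff)
  qed
  have scaled: "integrable lborel (\<lambda>s. I (0 + x * s))"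
    "(\<integral>s. I (0 + x * s) \<partial>lborel) = Gamma \<alpha> / x" if "0 < x" for x
    using that I lborel_integrable_real_affine[of I x 0] lborel_integral_real_affine[of x I 0]
    by (auto simp: has_bochner_integral_iff field_simps)
  show "RL_kernel \<alpha> \<in> laplace_transformable"
    unfolding borel_version_transformable_iff[OF version]
    using scaled(1) by (auto simp: eq)
  show "laplace (RL_kernel \<alpha>) x = x powr (- \<alpha>)" if "0 < x"
    unfolding borel_version_laplace[OF version] eq[OF that]
    using that scaled(2)[OF that] G by (simp add: powr_diff powr_minus field_simps)
qed

lemma one_transformable: "(\<lambda>t. 1) \<in> laplace_transformable"
  and laplace_one: "0 < x \<Longrightarrow> laplace (\<lambda>t. 1) x = 1 / x"
proof -
  \<comment> \<open>The kernel of order 1 is \<open>t powr 0 / Gamma 1\<close>, which is 1 for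
    \<open>t > 0\<close>.\<close>
  have eq: "(\<lambda>t. 1) =\<^sub>a\<^sub>e RL_kernel 1"
    by (auto simp: ae_eq_def RL_kernel_def)
  note RL = RL_kernel_laplace[OF zero_less_one]
  show "(\<lambda>t. 1) \<in> laplace_transformable"
    by (rule laplace_cong_ae(1)[OF RL(1) eq])
  show "laplace (\<lambda>t. 1) x = 1 / x" if "0 < x"
    using laplace_cong_ae(2)[OF RL(1) eq] RL(2)[OF that] that by (simp add: powr_minus_divide)
qed

section \<open>Cauchy's functional equation on the positive half line\<close>

text \<open>Continuity at \<open>a\<close> enters through boundedness of \<open>M\<close> near
  \<open>a\<close>. A nonzero value \<open>M u\<close> has unbounded multiples, and rational shifts
  carry them all into that neighbourhood.\<close>

lemma additive_vanishing_at_one: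
  fixes M :: "real \<Rightarrow> real"
  assumes add: "\<And>u v. 0 < u \<Longrightarrow> 0 < v \<Longrightarrow> M (u + v) = M u + M v"
    and one: "M 1 = 0"
    and a: "0 < a" and cont: "continuous (at a within {0<..}) M"
    and u: "0 < u"
  shows "M u = 0"
proof (rule ccontr)
  assume neq: "M u \<noteq> 0"
  have mult: "M (real (Suc n) * v) = real (Suc n) * M v" if "0 < v" for n v
  proof (induction n)
    case (Suc n)
    have "M (real (Suc n) * v + v) = M (real (Suc n) * v) + M v"
      using that by (intro add) auto
    then show ?case using Suc by (simp add: algebra_simps)
  qed simp
  have rat: "M r = 0" if r: "r \<in> \<rat>" "0 < r" for r
  proof -
    obtain m n :: nat where mn: "n \<noteq> 0" "\<bar>r\<bar> = real m / real n"
      using Rats_abs_nat_div_natE[OF r(1)] by metis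
    have "m \<noteq> 0" using mn r by (metis abs_0_eq div_0 less_irrefl of_nat_0)
    then obtain m' n' where S: "m = Suc m'" "n = Suc n'"
      using mn(1) by (meson not0_implies_Suc)
    have "real (Suc n') * r = real (Suc m') * 1"
      using mn r S by (simp add: field_simps del: of_nat_Suc)
    then have "real (Suc n') * M r = 0"
      using mult[OF r(2), of n'] mult[of 1 m'] one by simp
    then show ?thesis by (simp del: of_nat_Suc)
  qed
  obtain d where d: "0 < d" "\<And>v. 0 < v \<Longrightarrow> dist v a < d \<Longrightarrow> dist (M v) (M a) < 1"
    using cont unfolding continuous_within_eps_delta by (metis greaterThan_iff zero_less_one)
  \<comment> \<open>Since \<open>M\<close> vanishes on the positive rationals, every value \<open>n * M u\<close> is attained arbitrarily close to \<open>a\<close>.\<close>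
  have bound: "real (Suc n) * \<bar>M u\<bar> \<le> \<bar>M a\<bar> + 1" for n
  proof -
    define w where "w = real (Suc n) * u"
    have w: "0 < w" "M w = real (Suc n) * M u"
      using u mult[OF u] by (simp_all add: w_def)
    \<comment> \<open>The rational shift places \<open>w + r\<close> strictly between
      \<open>a\<close> and \<open>a + d\<close>, so it is positive even when \<open>r\<close> is
      negative.\<close>
    obtain r where r: "r \<in> \<rat>" "a - w < r" "r < a - w + d"
      using Rats_dense_in_real[of "a - w" "a - w + d"] d(1) by auto
    have "M (w + r) = M w"
    proof (cases r "0 :: real" rule: linorder_cases)
      \<comment> \<open>Additivity is available for positive arguments, so \<open>w\<close> is split
        as the sum of \<open>w + r\<close> and \<open>- r\<close>.\<close>
      case less
      have "M (w + r + (- r)) = M (w + r) + M (- r)"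
        using less r a by (intro add) auto
      then show ?thesis using rat[of "- r"] r(1) less by simp
    next
      case greater
      then show ?thesis using add[OF w(1)] rat[of r] r(1) by simp
    qed simp
    moreover have "dist (M (w + r)) (M a) < 1"
      using r a by (intro d(2)) (auto simp: dist_real_def)
    ultimately have "\<bar>real (Suc n) * M u\<bar> \<le> \<bar>M a\<bar> + 1"
      using w(2) by (simp add: dist_real_def)
    then show ?thesis by (simp add: abs_mult)
  qed
  obtain n :: nat where n: "\<bar>M a\<bar> + 1 < real n * \<bar>M u\<bar>"
    using reals_Archimedean3[of "\<bar>M u\<bar>"] neq by auto
  also have "\<dots> \<le> real (Suc n) * \<bar>M u\<bar>"
    by (intro mult_right_mono) auto
  finally show False using bound[of n] by simp
qed

text \<open>Once \<open>k\<close> is known to be positive, \<open>ln (k u) - u * ln (k 1)\<close> is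
  additive and vanishes at 1, which reduces the claim to the additive case.\<close>

lemma multiplicative_powr:
  fixes k :: "real \<Rightarrow> real"
  assumes mult: "\<And>u v. 0 < u \<Longrightarrow> 0 < v \<Longrightarrow> k (u + v) = k u * k v"
    and one: "k 1 \<noteq> 0"
    and a: "0 < a" and cont: "continuous (at a within {0<..}) k"
    and u: "0 < u"
  shows "k u = k 1 powr u"
proof -
  have nz: "k v \<noteq> 0" if "0 < v" for v
  proof -
    have pow: "k (real (Suc n)) = k 1 ^ Suc n" for n
    proof (induction n)
      case (Suc n)
      then show ?case using mult[of "real (Suc n)" 1] by (simp add: algebra_simps)
    qed simp
    obtain n where n: "v < real n"
      using reals_Archimedean2 by blast
    \<comment> \<open>A zero at \<open>v\<close> would force a zero at the larger integer
      \<open>Suc n\<close>, where \<open>k\<close> is a power of \<open>k 1\<close>.\<close>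
    then have "k (real (Suc n)) = k v * k (real (Suc n) - v)"
      using mult[of v "real (Suc n) - v"] that by simp
    then show ?thesis using pow[of n] one by auto
  qed
  have pos: "0 < k v" if "0 < v" for v
    \<comment> \<open>\<open>k v\<close> is the square of the nonzero number
      \<open>k (v / 2)\<close>.\<close>
    using mult[of "v / 2" "v / 2"] nz[of "v / 2"] that by (simp flip: power2_eq_square)
  have "ln (k u) - u * ln (k 1) = 0"
  proof (rule additive_vanishing_at_one[OF _ _ a _ u])
    show "ln (k (v + w)) - (v + w) * ln (k 1) = (ln (k v) - v * ln (k 1)) + (ln (k w) - w * ln (k 1))"
      if "0 < v" "0 < w" for v w
      using that pos[of v] pos[of w] by (simp add: mult ln_mult algebra_simps)
    show "continuous (at a within {0<..}) (\<lambda>v. ln (k v) - v * ln (k 1))"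
      using cont nz[OF a] by (intro continuous_intros) auto
  qed simp
  then have "k u = exp (u * ln (k 1))"
    using pos[OF u] by (metis eq_iff_diff_eq_0 exp_ln)
  then show ?thesis using one by (simp add: powr_def)
qed

section \<open>Characterisation of the Riemann-Liouville integral\<close>

theorem theorem4p1:
  fixes K :: "real \<Rightarrow> real \<Rightarrow> real"
    and J :: "real \<Rightarrow> (real \<Rightarrow> real) \<Rightarrow> real \<Rightarrow> real"
  assumes K: "\<And>\<alpha>. 0 < \<alpha> \<Longrightarrow> K \<alpha> \<in> laplace_transformable"
    and J: "\<And>\<alpha> f. 0 < \<alpha> \<Longrightarrow> f \<in> laplace_transformable \<Longrightarrow> J \<alpha> f =\<^sub>a\<^sub>e convolution (K \<alpha>) f"
  shows "((\<forall>x>0. \<exists>a>0. continuous (at a within {0<..}) (\<lambda>\<alpha>. laplace (K \<alpha>) x)) \<longleftrightarrow>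
          (\<forall>f\<in>laplace_transformable. \<forall>x>0. \<exists>a>0.
             continuous (at a within {0<..}) (\<lambda>\<alpha>. laplace (J \<alpha> f) x))) \<and>
         (K 1 =\<^sub>a\<^sub>e (\<lambda>t. 1) \<and>
          (\<forall>\<alpha>>0. \<forall>\<beta>>0. \<forall>f\<in>laplace_transformable. J (\<alpha> + \<beta>) f =\<^sub>a\<^sub>e J \<alpha> (J \<beta> f)) \<and>
          (\<forall>x>0. \<exists>a>0. continuous (at a within {0<..}) (\<lambda>\<alpha>. laplace (K \<alpha>) x))
          \<longrightarrow> (\<forall>\<alpha>>0. \<forall>f\<in>laplace_transformable. J \<alpha> f =\<^sub>a\<^sub>e RL_integral \<alpha> f))"
proof (intro conjI iffI ballI allI impI)
  have JL: "J \<alpha> f \<in> laplace_transformable"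
    if "0 < \<alpha>" "f \<in> laplace_transformable" for \<alpha> f
    using laplace_cong_ae(1)[OF laplace_convolution(1)[OF K] J] that by blast
  have laplace_J: "laplace (J \<alpha> f) x = laplace (K \<alpha>) x * laplace f x"
    if "0 < \<alpha>" "f \<in> laplace_transformable" "0 < x" for \<alpha> f x
    using laplace_cong_ae(2)[OF laplace_convolution(1)[OF K] J] laplace_convolution(2)[OF K] that by metis
  show "\<exists>a>0. continuous (at a within {0<..}) (\<lambda>\<alpha>. laplace (J \<alpha> f) x)"
    if cont: "\<forall>x>0. \<exists>a>0. continuous (at a within {0<..}) (\<lambda>\<alpha>. laplace (K \<alpha>) x)"
      and f: "f \<in> laplace_transformable" and x: "0 < x" for f x
  proof -
    obtain a where a: "0 < a" "continuous (at a within {0<..}) (\<lambda>\<alpha>. laplace (K \<alpha>) x)"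
      using cont x by blast
    then have "continuous (at a within {0<..}) (\<lambda>\<alpha>. laplace (K \<alpha>) x * laplace f x)"
      by (intro continuous_intros)
    then have "continuous (at a within {0<..}) (\<lambda>\<alpha>. laplace (J \<alpha> f) x)"
      \<comment> \<open>The two functions of \<alpha> are known to agree for positive orders, hence
        the transfer within \<open>{0<..}\<close>; the radius 1 is arbitrary.\<close>
      by (rule continuous_transform_within[OF _ zero_less_one]) (use a f x in \<open>auto simp: laplace_J\<close>)
    then show ?thesis using a(1) by blast
  qed
  show "\<exists>a>0. continuous (at a within {0<..}) (\<lambda>\<alpha>. laplace (K \<alpha>) x)"
    if cont: "\<forall>f\<in>laplace_transformable. \<forall>x>0. \<exists>a>0. continuous (at a within {0<..}) (\<lambda>\<alpha>. laplace (J \<alpha> f) x)"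
      and x: "0 < x" for x
  proof -
    \<comment> \<open>The test function 1 gives \<open>laplace (K \<alpha>) x / x\<close>, and
      multiplying by the constant \<open>x\<close> recovers the kernel's transform.\<close>
    obtain a where a: "0 < a" "continuous (at a within {0<..}) (\<lambda>\<alpha>. laplace (J \<alpha> (\<lambda>t. 1)) x)"
      using cont x one_transformable by blast
    then have "continuous (at a within {0<..}) (\<lambda>\<alpha>. laplace (J \<alpha> (\<lambda>t. 1)) x * x)"
      by (intro continuous_intros)
    then have "continuous (at a within {0<..}) (\<lambda>\<alpha>. laplace (K \<alpha>) x)"
      by (rule continuous_transform_within[OF _ zero_less_one])
        (use a x in \<open>auto simp: laplace_J one_transformable laplace_one\<close>)
    then show ?thesis using a(1) by blast
  qed
  fix \<alpha> :: real and f
  assume hyps: "K 1 =\<^sub>a\<^sub>e (\<lambda>t. 1) \<and>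
      (\<forall>\<alpha>>0. \<forall>\<beta>>0. \<forall>f\<in>laplace_transformable. J (\<alpha> + \<beta>) f =\<^sub>a\<^sub>e J \<alpha> (J \<beta> f)) \<and>
      (\<forall>x>0. \<exists>a>0. continuous (at a within {0<..}) (\<lambda>\<alpha>. laplace (K \<alpha>) x))"
    and \<alpha>: "0 < \<alpha>" and f: "f \<in> laplace_transformable"
  have laplace_K: "laplace (K \<alpha>) x = x powr (- \<alpha>)" if x: "0 < x" for x
  proof -
    have K1: "laplace (K 1) x = 1 / x"
      using hyps laplace_cong_ae(2)[OF one_transformable, of "K 1"] laplace_one[OF x] by simp
    have "laplace (K (u + v)) x = laplace (K u) x * laplace (K v) x" if uv: "0 < u" "0 < v" for u v
    proof -
      have "J (u + v) (\<lambda>t. 1) =\<^sub>a\<^sub>e J u (J v (\<lambda>t. 1))"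
        using hyps uv one_transformable by blast
      then have "laplace (J (u + v) (\<lambda>t. 1)) x = laplace (J u (J v (\<lambda>t. 1))) x"
        using uv one_transformable by (intro laplace_cong_ae(2) JL)
      then show ?thesis
        \<comment> \<open>The common factor \<open>1 / x\<close> from the test function
          cancels.\<close>
        using uv x by (simp add: laplace_J JL one_transformable laplace_one)
    qed
    \<comment> \<open>The point of continuity may depend on \<open>x\<close>; the functional
      equation is solved for each \<open>x\<close> separately.\<close>
    moreover obtain a where "0 < a" "continuous (at a within {0<..}) (\<lambda>\<alpha>. laplace (K \<alpha>) x)"
      using hyps x by blast
    ultimately have "laplace (K \<alpha>) x = laplace (K 1) x powr \<alpha>"
      using x \<alpha> K1 by (intro multiplicative_powr[of "\<lambda>\<alpha>. laplace (K \<alpha>) x"]) auto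
    then show ?thesis
      using x by (simp add: K1 powr_minus_divide powr_divide)
  qed
  \<comment> \<open>Both sides have transform \<open>x powr (- \<alpha>) * laplace f x\<close>, so
    injectivity applies to the images of \<open>f\<close>.\<close>
  show "J \<alpha> f =\<^sub>a\<^sub>e RL_integral \<alpha> f"
    unfolding RL_integral_eq_convolution
    using \<alpha> f RL_kernel_laplace[OF \<alpha>]
    by (intro laplace_inject_ae JL laplace_convolution(1))
      (auto simp: laplace_J laplace_K laplace_convolution(2))
qed

end
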